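(* Let $\pi\colon(X,T)\to(Y,S)$ be a factor map between dynamical systems and $n\geq 2$. If $(Y,S)$ is $n$-tuplewise IP-sensitive and $\pi$ is semi-open, then $(X,T)$ is also $n$-tuplewise IP-sensitive.
   Context: A dynamical system is a pair $(X,T)$ where $X$ is a compact metric space with metric $d$ and $T\colon X\to X$ is a continuous surjection. $\mathbb{N}$ is the set of positive integers. A factor map $\pi\colon(X,T)\to(Y,S)$ is a continuous surjection with $\pi\circ T=S\circ\pi$. A map $\pi\colon X\to Y$ is semi-open if $\pi(U)$ has non-empty interior for every non-empty open $U\subset X$. A set $F\subset\mathbb{N}$ is an IP-set if there is a sequence $(p_i)_{i\ge1}$ in $\mathbb{N}$ such that $\sum_{i\in\alpha}p_i\in F$ for every non-empty finite $\alpha\subset\mathbb{N}$. $(X,T)$ is $n$-tuplewise IP-sensitive if there is a constant $\delta>0$ such that for every non-empty open $U\subset X$ there exist $x_1,\dots,x_n\in U$ such that $\{k\in\mathbb{N}: \min_{1\le i<j\le n}d(T^kx_i,T^kx_j)>\delta\}$ is an IP-set. *)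

theory Defs
  imports "HOL-Analysis.Analysis"
begin

text \<open>
  Spaces are subsets of metric types, and "open", "interior" are always meant
  relative to the space (\<open>top_of_set X\<close>), not to the ambient type.
\<close>

definition dynamical_system :: "'a::metric_space set \<Rightarrow> ('a \<Rightarrow> 'a) \<Rightarrow> bool" where
  "dynamical_system X T \<longleftrightarrow> compact X \<and> continuous_on X T \<and> T ` X = X"

definition factor_map ::
  "'a::metric_space set \<Rightarrow> ('a \<Rightarrow> 'a) \<Rightarrow> 'b::metric_space set \<Rightarrow> ('b \<Rightarrow> 'b) \<Rightarrow> ('a \<Rightarrow> 'b) \<Rightarrow> bool"
where
  "factor_map X T Y S \<pi> \<longleftrightarrow>
     continuous_on X \<pi> \<and> \<pi> ` X = Y \<and> (\<forall>x\<in>X. \<pi> (T x) = S (\<pi> x))"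

definition semi_open_map ::
  "'a::metric_space set \<Rightarrow> 'b::metric_space set \<Rightarrow> ('a \<Rightarrow> 'b) \<Rightarrow> bool"
where
  "semi_open_map X Y \<pi> \<longleftrightarrow>
     (\<forall>U. openin (top_of_set X) U \<and> U \<noteq> {} \<longrightarrow> (top_of_set Y) interior_of (\<pi> ` U) \<noteq> {})"

text \<open>
  The natural numbers are the positive integers here, both for the elements of \<open>F\<close>
  and for the index set of the sequence; the value \<open>p 0\<close> is never used.
\<close>

definition IP_set :: "nat set \<Rightarrow> bool" where
  "IP_set F \<longleftrightarrow> F \<subseteq> {1..} \<and>
     (\<exists>p::nat \<Rightarrow> nat. (\<forall>i\<ge>1. p i \<ge> 1) \<and>
        (\<forall>\<alpha>. finite \<alpha> \<and> \<alpha> \<noteq> {} \<and> \<alpha> \<subseteq> {1..} \<longrightarrow> (\<Sum>i\<in>\<alpha>. p i) \<in> F))"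

text \<open>
  Only meaningful for \<open>n \<ge> 2\<close>; otherwise the minimum is over the empty set.
  The tuple is \<open>x 1, \<dots>, x n\<close>; other values of \<open>x\<close> are irrelevant.
\<close>

definition tuplewise_IP_sensitive ::
  "nat \<Rightarrow> 'a::metric_space set \<Rightarrow> ('a \<Rightarrow> 'a) \<Rightarrow> bool"
where
  "tuplewise_IP_sensitive n X T \<longleftrightarrow>
     (\<exists>\<delta>>0. \<forall>U. openin (top_of_set X) U \<and> U \<noteq> {} \<longrightarrow>
        (\<exists>x::nat \<Rightarrow> 'a. (\<forall>i\<in>{1..n}. x i \<in> U) \<and>
           IP_set {k. k \<ge> 1 \<and>
             Min {dist ((T ^^ k) (x i)) ((T ^^ k) (x j)) | i j. 1 \<le> i \<and> i < j \<and> j \<le> n} > \<delta>}))"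

end

theory Submission
  imports Defs
begin

text \<open>Separation in Y pulls back to X with uniform control. Since X is compact, \<pi> is
  uniformly continuous, so points of X whose images are more than \<delta> apart are at least some
  \<epsilon> apart, with \<epsilon> depending only on \<pi> and \<delta>. Given a non-empty open U
  in X, semi-openness makes the interior V of \<pi>(U) non-empty; a sensitive tuple in V lifts to a
  tuple in U. As \<pi> intertwines the iterates (\<open>factor_map_funpow\<close>), every time that
  separates the tuple in Y also separates its lift, and a set of positive integers containing an
  IP-set is an IP-set (\<open>IP_set_mono\<close>).\<close>

lemma IP_set_mono: "IP_set F \<Longrightarrow> F \<subseteq> G \<Longrightarrow> G \<subseteq> {1..} \<Longrightarrow> IP_set G"
  unfolding IP_set_def by (meson subsetD)

text \<open>\<open>Min\<close> is meaningful only on a finite non-empty set; the bound on n supplies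
  the pair (1, 2). This allows each pair to be treated separately.\<close>

lemma Min_pairs_gr_iff:
  fixes f :: "nat \<Rightarrow> nat \<Rightarrow> real"
  assumes "n \<ge> 2"
  shows "Min {f i j | i j. 1 \<le> i \<and> i < j \<and> j \<le> n} > c
    \<longleftrightarrow> (\<forall>i j. 1 \<le> i \<and> i < j \<and> j \<le> n \<longrightarrow> f i j > c)"
proof -
  let ?M = "{f i j | i j. 1 \<le> i \<and> i < j \<and> j \<le> n}"
  have "?M \<subseteq> (\<lambda>(i, j). f i j) ` ({..n} \<times> {..n})"
    by auto
  then have "finite ?M"
    by (rule finite_subset) simp
  moreover have "f 1 2 \<in> ?M"
    using assms by force
  ultimately have "Min ?M > c \<longleftrightarrow> (\<forall>a\<in>?M. a > c)"
    by (intro Min_gr_iff) auto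
  then show ?thesis
    by blast
qed

lemma factor_map_funpow:
  assumes "factor_map X T Y S \<pi>" "T ` X = X" "x \<in> X"
  shows "(T ^^ k) x \<in> X \<and> \<pi> ((T ^^ k) x) = (S ^^ k) (\<pi> x)"
proof (induction k)
  case 0
  show ?case using assms by simp
next
  case (Suc k)
  then show ?case
    using assms by (auto simp: factor_map_def)
qed

theorem lemma3p5:
  fixes X :: "'a::metric_space set" and T :: "'a \<Rightarrow> 'a"
    and Y :: "'b::metric_space set" and S :: "'b \<Rightarrow> 'b"
    and \<pi> :: "'a \<Rightarrow> 'b" and n :: nat
  assumes "dynamical_system X T"
    and "dynamical_system Y S"
    and "factor_map X T Y S \<pi>"
    and "n \<ge> 2"
    and "tuplewise_IP_sensitive n Y S"
    and "semi_open_map X Y \<pi>"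
  shows "tuplewise_IP_sensitive n X T"
proof -
  have "compact X" and TX: "T ` X = X"
    using assms(1) by (auto simp: dynamical_system_def)
  obtain \<delta> where "\<delta> > 0" and \<delta>: "\<And>V. openin (top_of_set Y) V \<Longrightarrow> V \<noteq> {} \<Longrightarrow>
      \<exists>y::nat \<Rightarrow> 'b. (\<forall>i\<in>{1..n}. y i \<in> V) \<and>
        IP_set {k. k \<ge> 1 \<and>
          Min {dist ((S ^^ k) (y i)) ((S ^^ k) (y j)) | i j. 1 \<le> i \<and> i < j \<and> j \<le> n} > \<delta>}"
    using assms(5) unfolding tuplewise_IP_sensitive_def by blast
  have "uniformly_continuous_on X \<pi>"
    using \<open>compact X\<close> assms(3)
    by (intro compact_uniformly_continuous) (auto simp: factor_map_def)
  then obtain \<epsilon> where "\<epsilon> > 0"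
    and \<epsilon>: "\<And>x x'. x \<in> X \<Longrightarrow> x' \<in> X \<Longrightarrow> dist x x' < \<epsilon> \<Longrightarrow> dist (\<pi> x) (\<pi> x') < \<delta>"
    using \<open>\<delta> > 0\<close> by (metis uniformly_continuous_onE)
  \<comment> \<open>The contrapositive of uniform continuity gives only distance \<ge> \<epsilon>,
    whereas sensitivity asks for a strict inequality; halving \<epsilon> restores
    strictness.\<close>
  show ?thesis
    unfolding tuplewise_IP_sensitive_def
  proof (intro exI[of _ "\<epsilon> / 2"] conjI allI impI)
    show "\<epsilon> / 2 > 0"
      using \<open>\<epsilon> > 0\<close> by simp
  next
    fix U assume U: "openin (top_of_set X) U \<and> U \<noteq> {}"
    then have "U \<subseteq> X"
      using openin_imp_subset by blast
    \<comment> \<open>The interior is used because sensitivity of Y applies to open sets only, while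
      \<pi>(U) itself may fail to be open.\<close>
    define V where "V = (top_of_set Y) interior_of (\<pi> ` U)"
    have "openin (top_of_set Y) V" "V \<noteq> {}"
      using U assms(6) by (auto simp: V_def semi_open_map_def)
    from \<delta>[OF this] obtain y where y: "\<forall>i\<in>{1..n}. y i \<in> V"
      and IP: "IP_set {k. k \<ge> 1 \<and>
        Min {dist ((S ^^ k) (y i)) ((S ^^ k) (y j)) | i j. 1 \<le> i \<and> i < j \<and> j \<le> n} > \<delta>}"
      by blast
    have "V \<subseteq> \<pi> ` U"
      unfolding V_def by (rule interior_of_subset)
    with y have "\<forall>i\<in>{1..n}. \<exists>x. x \<in> U \<and> \<pi> x = y i"
      by (metis (no_types, lifting) imageE subsetD)
    then obtain x where x: "\<And>i. i \<in> {1..n} \<Longrightarrow> x i \<in> U" "\<And>i. i \<in> {1..n} \<Longrightarrow> \<pi> (x i) = y i"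
      by metis
    \<comment> \<open>If the lifted orbits were \<epsilon>-close at time k, their images, which are
      the orbits of \<open>y i\<close> and \<open>y j\<close>, would be \<delta>-close.\<close>
    have "dist ((T ^^ k) (x i)) ((T ^^ k) (x j)) > \<epsilon> / 2"
      if "dist ((S ^^ k) (y i)) ((S ^^ k) (y j)) > \<delta>" and "i \<in> {1..n}" "j \<in> {1..n}" for k i j
    proof -
      have lift: "(T ^^ k) (x l) \<in> X" "\<pi> ((T ^^ k) (x l)) = (S ^^ k) (y l)" if "l \<in> {1..n}" for l
        using factor_map_funpow[OF assms(3) TX, of "x l" k] x[OF that] \<open>U \<subseteq> X\<close> by auto
      have "\<not> dist ((T ^^ k) (x i)) ((T ^^ k) (x j)) < \<epsilon>"
        using \<epsilon>[of "(T ^^ k) (x i)" "(T ^^ k) (x j)"] lift that by fastforce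
      then show ?thesis
        using \<open>\<epsilon> > 0\<close> by linarith
    qed
    then have "{k. k \<ge> 1 \<and>
        Min {dist ((S ^^ k) (y i)) ((S ^^ k) (y j)) | i j. 1 \<le> i \<and> i < j \<and> j \<le> n} > \<delta>}
      \<subseteq> {k. k \<ge> 1 \<and>
        Min {dist ((T ^^ k) (x i)) ((T ^^ k) (x j)) | i j. 1 \<le> i \<and> i < j \<and> j \<le> n} > \<epsilon> / 2}"
      unfolding Min_pairs_gr_iff[OF assms(4)] by auto
    with IP have "IP_set {k. k \<ge> 1 \<and>
        Min {dist ((T ^^ k) (x i)) ((T ^^ k) (x j)) | i j. 1 \<le> i \<and> i < j \<and> j \<le> n} > \<epsilon> / 2}"
      by (rule IP_set_mono) auto
    with x(1) show "\<exists>x. (\<forall>i\<in>{1..n}. x i \<in> U) \<and> IP_set {k. k \<ge> 1 \<and>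
        Min {dist ((T ^^ k) (x i)) ((T ^^ k) (x j)) | i j. 1 \<le> i \<and> i < j \<and> j \<le> n} > \<epsilon> / 2}"
      by blast
  qed
qed

end
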